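(* Let $U:[0,\infty]\to[-\infty,+\infty]$ be a utility function, real-valued on $(0,\infty)$, that is concave, strictly increasing and differentiable, with continuous and strictly decreasing derivative $U'$ satisfying $U'(0)=\lim_{x\to0}U'(x)=\infty$ and $U'(\infty)=\lim_{x\to\infty}U'(x)=0$. Suppose that for every measurable space $(\mathcal{X},\mathcal{F})$, every sub-$\sigma$-algebra $\mathcal{F}_n\subseteq\mathcal{F}$ and every pair of probability measures $\mathbb{P}\gg\mathbb{Q}$ on $(\mathcal{X},\mathcal{F})$, the following holds: if $\varepsilon$ is $U$-optimal for $\mathbb{P}$ against $\mathbb{Q}$, then $\varepsilon_n:=\mathbb{E}^{\mathbb{P}}[\varepsilon\mid\mathcal{F}_n]$ is $U$-optimal for $\mathbb{P}_{\mathcal{F}_n}$ against $\mathbb{Q}_{\mathcal{F}_n}$. Then $U=\log$ up to affine transformations, i.e. there are constants $c>0$ and $d\in\mathbb{R}$ with $U(x)=c\log x+d$ for all $x\in(0,\infty)$.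
   Context: $\mathbb{P}\gg\mathbb{Q}$ means that $\mathbb{Q}$ is absolutely continuous with respect to $\mathbb{P}$. $\mathbb{P}_{\mathcal{F}_n},\mathbb{Q}_{\mathcal{F}_n}$ are the restrictions of $\mathbb{P},\mathbb{Q}$ to $\mathcal{F}_n$. A valid e-value for $\mathbb{P}$ is a measurable map $\varepsilon:\mathcal{X}\to[0,\infty]$ with $\mathbb{E}^{\mathbb{P}}[\varepsilon]\le1$. A valid e-value is $U$-optimal for $\mathbb{P}$ against $\mathbb{Q}$ if it maximizes $\mathbb{E}^{\mathbb{Q}}[U(\varepsilon)]$ over all valid e-values for $\mathbb{P}$; for $\mathbb{P}_{\mathcal{F}_n}$ against $\mathbb{Q}_{\mathcal{F}_n}$ the maximization is over $\mathcal{F}_n$-measurable valid e-values. Differentiability and the conditions on $U'$ refer to $(0,\infty)$. *)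

theory Defs
  imports "HOL-Probability.Probability"
begin

definition valid_e_value :: "'a measure \<Rightarrow> ('a \<Rightarrow> ennreal) \<Rightarrow> bool" where
  "valid_e_value P \<epsilon> \<longleftrightarrow> \<epsilon> \<in> borel_measurable P \<and> (\<integral>\<^sup>+x. \<epsilon> x \<partial>P) \<le> 1"

text \<open>
  The expectation of the extended-real function \<open>U \<circ> \<epsilon>\<close> is the integral of its positive part
  minus that of its negative part (\<^const>\<open>e2ennreal\<close> sends negative arguments to \<open>0\<close>).
  When both integrals are infinite the expectation does not exist, and it is set to \<open>-\<infinity>\<close>
  (in \<^typ>\<open>ereal\<close> the difference \<open>\<infinity> - \<infinity>\<close> would be \<open>\<infinity>\<close>). Such e-values never affect the
  maximization: the constant e-value \<open>1\<close> has expected utility \<open>U 1\<close>, which is finite.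
\<close>

definition expected_utility ::
    "'a measure \<Rightarrow> (ennreal \<Rightarrow> ereal) \<Rightarrow> ('a \<Rightarrow> ennreal) \<Rightarrow> ereal" where
  "expected_utility Q U \<epsilon> =
     (let pos = \<integral>\<^sup>+x. e2ennreal (U (\<epsilon> x)) \<partial>Q;
          neg = \<integral>\<^sup>+x. e2ennreal (- U (\<epsilon> x)) \<partial>Q
      in if neg = \<infinity> then -\<infinity> else enn2ereal pos - enn2ereal neg)"

definition U_optimal ::
    "(ennreal \<Rightarrow> ereal) \<Rightarrow> 'a measure \<Rightarrow> 'a measure \<Rightarrow> ('a \<Rightarrow> ennreal) \<Rightarrow> bool" where
  "U_optimal U P Q \<epsilon> \<longleftrightarrow>
     valid_e_value P \<epsilon> \<and>
     (\<forall>\<epsilon>'. valid_e_value P \<epsilon>' \<longrightarrow> expected_utility Q U \<epsilon>' \<le> expected_utility Q U \<epsilon>)"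

text \<open>
  If the supremum of the expected utility is \<open>\<infinity>\<close>, every e-value attaining \<open>\<infinity>\<close> is optimal in this
  sense, even one whose double is still a valid e-value (for \<open>U = log\<close> and infinite relative entropy,
  half the likelihood ratio). A passage to conditional expectations that preserves optimality can
  then not be expected, so it should be asked only of optimizers with finite expected utility.
\<close>

text \<open>
  Concavity on all of \<open>[0,\<infinity>]\<close>. For a strictly increasing \<open>U\<close> the value \<open>-\<infinity>\<close> can occur only at \<open>0\<close>
  and \<open>\<infinity>\<close> only at \<open>\<infinity>\<close>; in the one case where the left-hand side has the form \<open>-\<infinity> + \<infinity>\<close>
  (\<open>x = 0\<close> and \<open>y = \<infinity>\<close>, or vice versa) the right-hand side is \<open>U \<infinity> = \<infinity>\<close>, so the convention
  for that sum is irrelevant.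
\<close>

definition concave_utility :: "(ennreal \<Rightarrow> ereal) \<Rightarrow> bool" where
  "concave_utility U \<longleftrightarrow>
     (\<forall>x y. \<forall>t::real. 0 < t \<and> t < 1 \<longrightarrow>
        ereal (1 - t) * U x + ereal t * U y \<le> U (ennreal (1 - t) * x + ennreal t * y))"

end

theory Submission imports Defs begin

text \<open>
  On a finite probability space in which \<open>P\<close> and \<open>Q\<close> have the same atoms, maximizing
  \<open>\<Sum>i. q i * u (e i)\<close> under the budget \<open>\<Sum>i. p i * e i \<le> 1\<close> is a concave problem with one linear
  constraint, so a positive \<open>e\<close> that exhausts the budget is optimal if and only if
  \<open>q i * U' (e i) / p i\<close> does not depend on \<open>i\<close>. Sufficiency is the tangent inequality for the
  concave \<open>u\<close> (\<open>U_optimal_pmfI\<close>); necessity comes from moving wealth between two atoms and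
  differentiating (\<open>U_optimal_pmfD\<close>).

  The sufficient condition can be read backwards: any positive \<open>e\<close> with mean one under \<open>p\<close> is
  optimal against the alternative \<open>q\<close> proportional to \<open>p / U' e\<close>. So on three atoms the values
  \<open>x\<close>, \<open>y\<close> on two of them may be prescribed freely, the third atom balancing the budget.
  Merging the first two atoms, with relative masses \<open>s\<close> and \<open>1 - s\<close>, replaces \<open>x\<close>, \<open>y\<close> by their
  average, and adds up the corresponding weights of \<open>q\<close>. Coherence says that the merged e-value is
  still optimal, and the necessary condition, compared across the merged and the third atom, becomes
  \<open>1 / U' (s * x + (1 - s) * y) = s / U' x + (1 - s) / U' y\<close> (\<open>inverse_derivative_affine\<close>).

  Hence \<open>1 / U'\<close> is affine. Since \<open>U'\<close> tends to infinity at \<open>0\<close>, it is even linear, that is,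
  \<open>U' x = U' 1 / x\<close> (\<open>derivative_reciprocal\<close>), and integration gives the logarithm.
\<close>

section \<open>Expected utilities\<close>

text \<open>
  Integrability keeps the positive and the negative part finite, so that their difference is an
  ordinary expectation.
\<close>

lemma expected_utility_eq_integral:
  assumes w: "integrable Q w" and eq: "AE x in Q. U (\<epsilon> x) = ereal (w x)"
  shows "expected_utility Q U \<epsilon> = ereal (\<integral>x. w x \<partial>Q)"
proof -
  have pos: "(\<integral>\<^sup>+x. e2ennreal (U (\<epsilon> x)) \<partial>Q) = (\<integral>\<^sup>+x. ennreal (w x) \<partial>Q)"
    using eq by (intro nn_integral_cong_AE) (auto simp: ennreal_def e2ennreal_def)
  have neg: "(\<integral>\<^sup>+x. e2ennreal (- U (\<epsilon> x)) \<partial>Q) = (\<integral>\<^sup>+x. ennreal (- w x) \<partial>Q)"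
    using eq by (intro nn_integral_cong_AE) (auto simp: ennreal_def e2ennreal_def)
  have "(\<integral>\<^sup>+x. ennreal (w x) \<partial>Q) \<noteq> \<infinity>" "(\<integral>\<^sup>+x. ennreal (- w x) \<partial>Q) \<noteq> \<infinity>"
    using w by (auto simp: real_integrable_def)
  then show ?thesis
    unfolding expected_utility_def pos neg real_lebesgue_integral_def[OF w]
    by (cases "\<integral>\<^sup>+x. ennreal (w x) \<partial>Q"; cases "\<integral>\<^sup>+x. ennreal (- w x) \<partial>Q")
      (auto simp: top_ennreal.rep_eq)
qed

text \<open>
  A real-valued integrable majorant suffices for an upper bound; the utility itself may be \<open>-\<infinity>\<close> with
  positive probability. Competitors that vanish on an atom are covered in this way.
\<close>

lemma expected_utility_le_integral:
  assumes w: "integrable Q w" and le: "AE x in Q. U (\<epsilon> x) \<le> ereal (w x)"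
  shows "expected_utility Q U \<epsilon> \<le> ereal (\<integral>x. w x \<partial>Q)"
proof -
  define pos neg where "pos = (\<integral>\<^sup>+x. e2ennreal (U (\<epsilon> x)) \<partial>Q)"
    and "neg = (\<integral>\<^sup>+x. e2ennreal (- U (\<epsilon> x)) \<partial>Q)"
  have pos: "pos \<le> (\<integral>\<^sup>+x. ennreal (w x) \<partial>Q)"
    unfolding pos_def using le
    by (intro nn_integral_mono_AE) (auto simp: e2ennreal_mono simp flip: e2ennreal_ereal)
  have neg: "(\<integral>\<^sup>+x. ennreal (- w x) \<partial>Q) \<le> neg"
    unfolding neg_def using le
  proof (intro nn_integral_mono_AE, eventually_elim)
    case (elim x)
    then have "ereal (- w x) \<le> - U (\<epsilon> x)"
      by (simp add: ereal_minus_le_minus flip: uminus_ereal.simps(1))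
    then show ?case
      by (metis e2ennreal_ereal e2ennreal_mono)
  qed
  have "(\<integral>\<^sup>+x. ennreal (w x) \<partial>Q) \<noteq> \<infinity>" "(\<integral>\<^sup>+x. ennreal (- w x) \<partial>Q) \<noteq> \<infinity>"
    using w by (auto simp: real_integrable_def)
  then show ?thesis
    using pos neg
    unfolding expected_utility_def pos_def[symmetric] neg_def[symmetric] real_lebesgue_integral_def[OF w]
    by (cases "\<integral>\<^sup>+x. ennreal (w x) \<partial>Q"; cases "\<integral>\<^sup>+x. ennreal (- w x) \<partial>Q"; cases pos; cases neg)
      (auto simp: top_ennreal.rep_eq ennreal_le_iff top_unique)
qed

lemma valid_e_value_pmf_iff:
  assumes "finite (set_pmf p)" and "\<And>x. x \<in> set_pmf p \<Longrightarrow> \<epsilon> x = ennreal (e x) \<and> 0 \<le> e x"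
  shows "valid_e_value (measure_pmf p) \<epsilon> \<longleftrightarrow> (\<Sum>x\<in>set_pmf p. pmf p x * e x) \<le> 1"
proof -
  have "(\<integral>\<^sup>+x. \<epsilon> x \<partial>measure_pmf p) = (\<Sum>x\<in>set_pmf p. ennreal (pmf p x * e x))"
    unfolding nn_integral_measure_pmf_finite[OF assms(1), simplified]
    using assms(2) by (intro sum.cong) (auto simp: ennreal_mult' mult.commute)
  also have "\<dots> = ennreal (\<Sum>x\<in>set_pmf p. pmf p x * e x)"
    using assms(2) by (intro sum_ennreal) (auto simp: zero_le_mult_iff)
  finally show ?thesis
    by (simp add: valid_e_value_def)
qed

lemma finite_pmf_exists:
  assumes "finite S" "\<And>x. x \<in> S \<Longrightarrow> 0 < w x" "(\<Sum>x\<in>S. w x) = (1::real)"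
  obtains p where "set_pmf p = S" "\<And>x. x \<in> S \<Longrightarrow> pmf p x = w x"
proof -
  define v where "v x = (if x \<in> S then w x else 0)" for x
  have v0: "0 \<le> v x" for x
    using assms(2) by (auto simp: v_def intro: less_imp_le)
  have "(\<integral>\<^sup>+x. ennreal (v x) \<partial>count_space UNIV) = (\<Sum>x\<in>S. ennreal (v x))"
    using assms(1) by (intro nn_integral_count_space') (auto simp: v_def)
  also have "\<dots> = ennreal (\<Sum>x\<in>S. w x)"
    using assms(2) by (subst sum_ennreal) (auto simp: v_def intro: less_imp_le)
  finally have v1: "(\<integral>\<^sup>+x. ennreal (v x) \<partial>count_space UNIV) = 1"
    using assms(3) by simp
  show thesis
  proof
    show "set_pmf (embed_pmf v) = S"
      unfolding set_embed_pmf[OF v0 v1] using assms(2) by (force simp: v_def)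
    show "pmf (embed_pmf v) x = w x" if "x \<in> S" for x
      unfolding pmf_embed_pmf[OF v0 v1] using that by (simp add: v_def)
  qed
qed

section \<open>Optimality on finite probability spaces\<close>

locale smooth_utility =
  fixes U :: "ennreal \<Rightarrow> ereal" and U' :: "real \<Rightarrow> real"
  assumes real_valued: "\<And>x. 0 < x \<Longrightarrow> x < \<infinity> \<Longrightarrow> \<bar>U x\<bar> \<noteq> \<infinity>"
    and increasing: "strict_mono U"
    and derivative: "\<And>x::real. 0 < x \<Longrightarrow>
      ((\<lambda>y. real_of_ereal (U (ennreal y))) has_real_derivative U' x) (at x)"
    and decreasing: "strict_antimono_on {0<..} U'"
    and limit_infinity: "(U' \<longlongrightarrow> 0) at_top"
begin

definition u :: "real \<Rightarrow> real" where
  "u y = real_of_ereal (U (ennreal y))"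

lemma U_eq_u: "0 < x \<Longrightarrow> U (ennreal x) = ereal (u x)"
  using real_valued[of "ennreal x"] by (simp add: u_def ereal_real)

lemma u_deriv: "0 < x \<Longrightarrow> (u has_real_derivative U' x) (at x)"
  using derivative[of x] by (simp add: u_def[abs_def])

lemma U'_pos:
  assumes "0 < x"
  shows "0 < U' x"
proof -
  have "0 \<le> U' (x + 1)"
  proof (rule tendsto_upperbound[OF limit_infinity])
    show "\<forall>\<^sub>F y in at_top. U' y \<le> U' (x + 1)"
      using eventually_gt_at_top[of "x + 1"]
      by eventually_elim (use assms decreasing in \<open>auto simp: monotone_on_def intro: less_imp_le\<close>)
  qed simp
  also have "\<dots> < U' x"
    using assms decreasing by (auto simp: monotone_on_def)
  finally show ?thesis .
qed

text \<open>
  The slope \<open>U'\<close> decreases, so the graph of \<open>u\<close> lies below its tangents. The point \<open>y = 0\<close> is included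
  because a competing e-value may vanish on some atoms.
\<close>

lemma U_le_tangent:
  assumes "0 < x" "0 \<le> y"
  shows "U (ennreal y) \<le> ereal (u x + U' x * (y - x))"
proof -
  have pos: "u z \<le> u x + U' x * (z - x)" if "0 < z" for z
  proof -
    have "convex_on {0<..} (\<lambda>y. - u y)"
    proof (rule convex_on_realI)
      show "((\<lambda>y. - u y) has_real_derivative - U' y) (at y)" if "y \<in> {0<..}" for y
        using that u_deriv[of y] by (intro DERIV_minus) simp
      show "- U' y \<le> - U' z" if "y \<in> {0<..}" "z \<in> {0<..}" "y \<le> z" for y z
        using that decreasing by (cases "y = z") (auto simp: monotone_on_def intro: less_imp_le)
    qed auto
    moreover have "((\<lambda>y. - u y) has_real_derivative - U' x) (at x within {0<..})"
      by (rule DERIV_minus[OF has_field_derivative_at_within[OF u_deriv[OF assms(1)]]])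
    ultimately have "- u z - (- u x) \<ge> - U' x * (z - x)"
      using assms(1) that
      by (intro convex_on_imp_above_tangent[where A="{0<..}"]) (auto simp: interior_open)
    then show ?thesis by (simp add: algebra_simps)
  qed
  show ?thesis
  proof (cases "y = 0")
    case False
    then show ?thesis using pos[of y] U_eq_u[of y] assms by simp
  next
    case True
    \<comment> \<open>Monotonicity bounds \<open>U 0\<close> by the tangent line at every positive point, hence at \<open>0\<close>.\<close>
    have bound: "U 0 \<le> ereal (u x + U' x * (z - x))" if "0 < z" for z
    proof -
      have "U 0 \<le> U (ennreal z)"
        by (rule monoD[OF strict_mono_mono[OF increasing]]) simp
      also have "\<dots> \<le> ereal (u x + U' x * (z - x))"
        using U_eq_u[OF that] pos[OF that] by simp
      finally show ?thesis .
    qed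
    have "((\<lambda>z. u x + U' x * (z - x)) \<longlongrightarrow> u x + U' x * (0 - x)) (at_right 0)"
      by (intro tendsto_intros)
    then have "((\<lambda>z. ereal (u x + U' x * (z - x))) \<longlongrightarrow> ereal (u x + U' x * (0 - x))) (at_right 0)"
      by (intro tendsto_intros)
    then have "U 0 \<le> ereal (u x + U' x * (0 - x))"
      by (rule tendsto_lowerbound[OF _ eventually_mono[OF eventually_at_right_less bound] trivial_limit_at_right_real])
    then show ?thesis using True by simp
  qed
qed

lemma expected_utility_pmf:
  assumes "finite (set_pmf q)" "\<And>x. x \<in> set_pmf q \<Longrightarrow> \<epsilon> x = ennreal (e x) \<and> 0 < e x"
  shows "expected_utility (measure_pmf q) U \<epsilon> = ereal (\<Sum>x\<in>set_pmf q. pmf q x * u (e x))"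
proof -
  have "expected_utility (measure_pmf q) U \<epsilon> = ereal (\<integral>x. u (e x) \<partial>measure_pmf q)"
    using assms U_eq_u
    by (intro expected_utility_eq_integral) (auto simp: AE_measure_pmf_iff integrable_measure_pmf_finite)
  then show ?thesis
    using assms(1) by (subst (asm) integral_measure_pmf[OF assms(1)]) auto
qed

text \<open>
  The constant \<open>K\<close> is the Lagrange multiplier of the budget constraint. Summing the tangent
  inequalities at \<open>e\<close> with weights \<open>q\<close> bounds the gain of any competitor by \<open>K\<close> times the amount by
  which it exceeds the budget.
\<close>

lemma U_optimal_pmfI:
  assumes fin: "finite (set_pmf p)" and supp: "set_pmf q = set_pmf p"
    and e: "\<And>x. x \<in> set_pmf p \<Longrightarrow> \<epsilon> x = ennreal (e x) \<and> 0 < e x"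
    and mean: "(\<Sum>x\<in>set_pmf p. pmf p x * e x) = 1"
    and K: "0 \<le> K" "\<And>x. x \<in> set_pmf p \<Longrightarrow> pmf q x * U' (e x) = K * pmf p x"
  shows "U_optimal U (measure_pmf p) (measure_pmf q) \<epsilon>"
  unfolding U_optimal_def
proof (intro conjI allI impI)
  show "valid_e_value (measure_pmf p) \<epsilon>"
    using e mean by (subst valid_e_value_pmf_iff[OF fin, of _ e]) (auto intro: less_imp_le)
next
  fix \<epsilon>' assume \<epsilon>': "valid_e_value (measure_pmf p) \<epsilon>'"
  define y where "y x = enn2real (\<epsilon>' x)" for x
  have "(\<integral>\<^sup>+x. \<epsilon>' x \<partial>measure_pmf p) \<noteq> \<infinity>"
    using \<epsilon>' by (auto simp: valid_e_value_def top_unique)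
  then have "AE x in measure_pmf p. \<epsilon>' x \<noteq> \<infinity>"
    by (intro nn_integral_PInf_AE) auto
  then have y: "\<epsilon>' x = ennreal (y x) \<and> 0 \<le> y x" if "x \<in> set_pmf p" for x
    using that by (auto simp: AE_measure_pmf_iff y_def less_top)
  have budget: "(\<Sum>x\<in>set_pmf p. pmf p x * y x) \<le> 1"
    using \<epsilon>' valid_e_value_pmf_iff[OF fin, of \<epsilon>' y] y by simp
  let ?w = "\<lambda>x. u (e x) + U' (e x) * (y x - e x)"
  have "expected_utility (measure_pmf q) U \<epsilon>' \<le> ereal (\<integral>x. ?w x \<partial>measure_pmf q)"
    using e y supp fin U_le_tangent
    by (intro expected_utility_le_integral) (auto simp: AE_measure_pmf_iff integrable_measure_pmf_finite)
  also have "(\<integral>x. ?w x \<partial>measure_pmf q) = (\<Sum>x\<in>set_pmf p. pmf q x * ?w x)"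
    using fin supp by (subst integral_measure_pmf[of "set_pmf p"]) auto
  also have "\<dots> = (\<Sum>x\<in>set_pmf p. pmf q x * u (e x) + K * (pmf p x * y x) - K * (pmf p x * e x))"
  proof (intro sum.cong refl)
    fix x assume "x \<in> set_pmf p"
    from K(2)[OF this] show "pmf q x * ?w x = pmf q x * u (e x) + K * (pmf p x * y x) - K * (pmf p x * e x)"
      by (metis (no_types, opaque_lifting) add_diff_eq distrib_left mult.assoc right_diff_distrib)
  qed
  also have "\<dots> = (\<Sum>x\<in>set_pmf p. pmf q x * u (e x)) + K * ((\<Sum>x\<in>set_pmf p. pmf p x * y x) - 1)"
    unfolding sum_subtractf sum.distrib sum_distrib_left[symmetric] mean
    by (simp add: right_diff_distrib)
  also have "ereal \<dots> \<le> ereal (\<Sum>x\<in>set_pmf p. pmf q x * u (e x))"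
    using K(1) budget by (simp add: mult_nonneg_nonpos)
  also have "\<dots> = expected_utility (measure_pmf q) U \<epsilon>"
    using expected_utility_pmf[of q \<epsilon> e] fin supp e by simp
  finally show "expected_utility (measure_pmf q) U \<epsilon>' \<le> expected_utility (measure_pmf q) U \<epsilon>" .
qed

text \<open>
  Shifting the amount \<open>t\<close> of the budget from \<open>y\<close> to \<open>x\<close> changes the value on \<open>x\<close> by \<open>t / p x\<close> and that
  on \<open>y\<close> by \<open>- t / p y\<close>. Optimality makes \<open>t = 0\<close> an interior maximum of the expected utility, and
  its vanishing derivative is the difference of the two sides.
\<close>

lemma U_optimal_pmfD:
  assumes fin: "finite (set_pmf p)" and supp: "set_pmf q = set_pmf p"
    and e: "\<And>x. x \<in> set_pmf p \<Longrightarrow> \<epsilon> x = ennreal (e x) \<and> 0 < e x"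
    and opt: "U_optimal U (measure_pmf p) (measure_pmf q) \<epsilon>"
    and x: "x \<in> set_pmf p" and y: "y \<in> set_pmf p"
  shows "pmf q x * U' (e x) / pmf p x = pmf q y * U' (e y) / pmf p y"
proof -
  let ?S = "set_pmf p"
  define k where "k z = (if z = x then 1 / pmf p x else 0) - (if z = y then 1 / pmf p y else 0)" for z
  define \<phi> where "\<phi> t = (\<Sum>z\<in>?S. pmf q z * u (e z + t * k z))" for t
  \<comment> \<open>Used with \<open>c = p\<close>, where it says that the shift preserves the budget, and with \<open>c = q * U' e\<close>.\<close>
  have pk: "(\<Sum>z\<in>?S. c z * k z) = c x / pmf p x - c y / pmf p y" for c :: "_ \<Rightarrow> real"
    using x y fin by (simp add: k_def right_diff_distrib sum_subtractf if_distrib[of "(*) _"] cong: if_cong)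
  have budget: "(\<Sum>z\<in>?S. pmf p z * (e z + t * k z)) \<le> 1" for t
  proof -
    have "(\<Sum>z\<in>?S. pmf p z * (e z + t * k z)) = (\<Sum>z\<in>?S. pmf p z * e z) + t * (\<Sum>z\<in>?S. pmf p z * k z)"
      by (simp add: algebra_simps sum.distrib sum_distrib_left)
    also have "(\<Sum>z\<in>?S. pmf p z * k z) = 0"
      using x y by (simp add: pk pmf_eq_0_set_pmf)
    also have "(\<Sum>z\<in>?S. pmf p z * e z) \<le> 1"
      using opt valid_e_value_pmf_iff[OF fin, of \<epsilon> e] e by (auto simp: U_optimal_def intro: less_imp_le)
    finally show ?thesis by simp
  qed
  have "\<forall>\<^sub>F t in at 0. \<forall>z\<in>?S. 0 < e z + t * k z"
    unfolding eventually_ball_finite_distrib[OF fin]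
  proof
    fix z assume "z \<in> ?S"
    have "((\<lambda>t. e z + t * k z) \<longlongrightarrow> e z + 0 * k z) (at 0)"
      by (intro tendsto_intros)
    then show "\<forall>\<^sub>F t in at 0. 0 < e z + t * k z"
      using e[OF \<open>z \<in> ?S\<close>] by (intro order_tendstoD(1)[of _ "e z"]) auto
  qed
  then obtain d where d: "0 < d" "\<And>t z. t \<noteq> 0 \<Longrightarrow> \<bar>t\<bar> < d \<Longrightarrow> z \<in> ?S \<Longrightarrow> 0 < e z + t * k z"
    unfolding eventually_at dist_real_def by auto
  have pos: "0 < e z + t * k z" if "\<bar>t\<bar> < d" "z \<in> ?S" for t z
    using d(2)[of t z] that e by (cases "t = 0") auto
  have "\<phi> t \<le> \<phi> 0" if t: "\<bar>t\<bar> < d" for t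
  proof -
    let ?\<epsilon>' = "\<lambda>z. ennreal (e z + t * k z)"
    have "valid_e_value (measure_pmf p) ?\<epsilon>'"
      using budget pos[OF t]
      by (subst valid_e_value_pmf_iff[OF fin, of _ "\<lambda>z. e z + t * k z"]) (auto intro: less_imp_le)
    then have "expected_utility (measure_pmf q) U ?\<epsilon>' \<le> expected_utility (measure_pmf q) U \<epsilon>"
      using opt by (auto simp: U_optimal_def)
    moreover have "expected_utility (measure_pmf q) U ?\<epsilon>' = ereal (\<phi> t)"
      using pos[OF t] fin supp by (subst expected_utility_pmf[of q _ "\<lambda>z. e z + t * k z"]) (auto simp: \<phi>_def)
    moreover have "expected_utility (measure_pmf q) U \<epsilon> = ereal (\<phi> 0)"
      using e fin supp by (subst expected_utility_pmf[of q _ e]) (auto simp: \<phi>_def)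
    ultimately show ?thesis by simp
  qed
  moreover have "(\<phi> has_real_derivative (\<Sum>z\<in>?S. pmf q z * (U' (e z) * k z))) (at 0)"
    unfolding \<phi>_def
  proof (intro DERIV_sum DERIV_cmult)
    fix z assume "z \<in> ?S"
    have "((\<lambda>t. e z + t * k z) has_real_derivative k z) (at 0)"
      by (auto intro!: derivative_eq_intros)
    moreover have "(u has_real_derivative U' (e z)) (at (e z + 0 * k z))"
      using u_deriv e[OF \<open>z \<in> ?S\<close>] by simp
    ultimately show "((\<lambda>t. u (e z + t * k z)) has_real_derivative U' (e z) * k z) (at 0)"
      using DERIV_chain2[of u _ "\<lambda>t. e z + t * k z"] by blast
  qed
  ultimately have "(\<Sum>z\<in>?S. pmf q z * (U' (e z) * k z)) = 0"
    using DERIV_local_max[of \<phi> _ 0 d] d(1) by auto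
  then show ?thesis
    using pk[of "\<lambda>z. pmf q z * U' (e z)"] by (simp add: mult.assoc)
qed

end

section \<open>Coarse-graining a discrete space along a map\<close>

text \<open>
  The sub-\<open>\<sigma>\<close>-algebra of all unions of fibres of \<open>f\<close>: its measurable functions are the functions
  of \<open>f x\<close>, so restricting a discrete measure to it amounts to taking the image under \<open>f\<close>.
\<close>

abbreviation fibre_algebra :: "('a \<Rightarrow> 'b) \<Rightarrow> 'a measure" where
  "fibre_algebra f \<equiv> vimage_algebra UNIV f (count_space UNIV)"

lemma subalgebra_fibre_algebra: "subalgebra (measure_pmf p) (fibre_algebra f)"
  by (auto simp: subalgebra_def)

lemma measurable_comp_fibre_algebra: "(\<lambda>x. h (f x)) \<in> measurable (fibre_algebra f) (borel :: 'c::topological_space measure)"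
  by (rule measurable_compose[OF measurable_vimage_algebra1, of f UNIV "count_space UNIV"]) auto

text \<open>
  The level set of \<open>g\<close> through \<open>x\<close> is a union of fibres, so it contains the whole fibre of \<open>x\<close>.
\<close>

lemma measurable_fibre_algebra_const:
  fixes g :: "'a \<Rightarrow> 'c::t1_space"
  assumes g: "g \<in> borel_measurable (fibre_algebra f)" and "f x = f y"
  shows "g x = g y"
proof -
  have "g -` {g x} \<inter> space (fibre_algebra f) \<in> sets (fibre_algebra f)"
    using g by (rule measurable_sets) auto
  then obtain A where "g -` {g x} = f -` A"
    by (auto simp: sets_vimage_algebra2)
  then show ?thesis
    using assms(2) by (metis singletonD singletonI vimage_eq)
qed

text \<open>
  The conditional expectation is constant on the fibre of \<open>x\<close>, hence it is there the average of \<open>g\<close>.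
  In this multiplied form the identity holds also for fibres of measure zero.
\<close>

lemma nn_cond_exp_fibre:
  "nn_cond_exp (measure_pmf p) (fibre_algebra f) g x * emeasure (measure_pmf p) (f -` {f x}) =
    (\<integral>\<^sup>+y. indicator (f -` {f x}) y * g y \<partial>measure_pmf p)" (is "?E x * _ = _")
proof -
  interpret finite_measure_subalgebra "measure_pmf p" "fibre_algebra f"
    by unfold_locales (rule subalgebra_fibre_algebra)
  have ind: "(indicator (f -` {f x}) :: _ \<Rightarrow> ennreal) \<in> borel_measurable (fibre_algebra f)"
    by (intro borel_measurable_indicator) (auto simp: sets_vimage_algebra2)
  have "?E x * emeasure (measure_pmf p) (f -` {f x}) = (\<integral>\<^sup>+y. ?E x * indicator (f -` {f x}) y \<partial>measure_pmf p)"
    by (rule nn_integral_cmult_indicator[symmetric]) auto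
  also have "\<dots> = (\<integral>\<^sup>+y. indicator (f -` {f x}) y * ?E y \<partial>measure_pmf p)"
  proof (intro nn_integral_cong)
    fix y
    show "?E x * indicator (f -` {f x}) y = indicator (f -` {f x}) y * ?E y"
    proof (cases "f y = f x")
      case True
      then have "?E y = ?E x"
        by (rule measurable_fibre_algebra_const[OF borel_measurable_nn_cond_exp])
      then show ?thesis by (simp add: mult.commute)
    qed simp
  qed
  also have "\<dots> = (\<integral>\<^sup>+y. indicator (f -` {f x}) y * g y \<partial>measure_pmf p)"
    using ind by (rule nn_cond_exp_intg) auto
  finally show ?thesis .
qed

text \<open>
  Through \<open>g \<mapsto> (\<lambda>x. g (f x))\<close> every competitor on the image space becomes a competitor on the
  restricted space, with the same budget and the same expected utility. The optimality conditions
  for discrete spaces thus apply to coarse-grained problems.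
\<close>

lemma U_optimal_fibre_algebraD:
  assumes opt: "U_optimal U (restr_to_subalg (measure_pmf p) (fibre_algebra f))
      (restr_to_subalg (measure_pmf q) (fibre_algebra f)) (\<lambda>x. h (f x))"
  shows "U_optimal U (measure_pmf (map_pmf f p)) (measure_pmf (map_pmf f q)) h"
proof -
  let ?P = "restr_to_subalg (measure_pmf p) (fibre_algebra f)"
  let ?Q = "restr_to_subalg (measure_pmf q) (fibre_algebra f)"
  have int: "(\<integral>\<^sup>+x. g (f x) \<partial>restr_to_subalg (measure_pmf r) (fibre_algebra f)) = (\<integral>\<^sup>+x. g x \<partial>measure_pmf (map_pmf f r))"
    for r :: "'a pmf" and g :: "'b \<Rightarrow> ennreal"
    by (simp add: nn_integral_subalgebra2 subalgebra_fibre_algebra measurable_comp_fibre_algebra)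
  have "valid_e_value ?P (\<lambda>x. g (f x)) = valid_e_value (measure_pmf (map_pmf f p)) g" for g
    using measurable_comp_fibre_algebra[of g f]
    by (simp add: valid_e_value_def int measurable_in_subalg subalgebra_fibre_algebra del: nn_integral_map_pmf)
  moreover have "expected_utility ?Q U (\<lambda>x. g (f x)) = expected_utility (measure_pmf (map_pmf f q)) U g" for g
    unfolding expected_utility_def
    using int[of q "\<lambda>x. e2ennreal (U (g x))"] int[of q "\<lambda>x. e2ennreal (- U (g x))"] by simp
  ultimately show ?thesis
    using opt unfolding U_optimal_def by metis
qed

section \<open>Coherence forces the logarithm\<close>

lemma absolutely_continuous_pmf:
  assumes "set_pmf q \<subseteq> set_pmf p"
  shows "absolutely_continuous (measure_pmf p) (measure_pmf q)"
  using assms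
  by (auto simp: absolutely_continuous_def null_sets_def measure_pmf.emeasure_eq_measure measure_pmf_zero_iff)

text \<open>
  Preservation of optimality under coarse-graining, for discrete measures; equality of the supports
  makes them mutually absolutely continuous. The type argument records the type of the outcomes,
  which does not occur in the type of \<open>U\<close>.
\<close>

definition coherent_for_pmfs :: "'a itself \<Rightarrow> (ennreal \<Rightarrow> ereal) \<Rightarrow> bool" where
  "coherent_for_pmfs _ U \<longleftrightarrow> (\<forall>(p :: 'a pmf) q f \<epsilon>.
     set_pmf q = set_pmf p \<longrightarrow>
     U_optimal U (measure_pmf p) (measure_pmf q) \<epsilon> \<longrightarrow> expected_utility (measure_pmf q) U \<epsilon> < \<infinity> \<longrightarrow>
     U_optimal U (restr_to_subalg (measure_pmf p) (fibre_algebra (f :: 'a \<Rightarrow> 'a)))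
       (restr_to_subalg (measure_pmf q) (fibre_algebra f))
       (nn_cond_exp (measure_pmf p) (fibre_algebra f) \<epsilon>))"

text \<open>
  The functional equation behind the logarithm. Atoms \<open>a\<close> and \<open>b\<close> carry the values \<open>x\<close> and \<open>y\<close> with
  masses \<open>\<delta> * s\<close> and \<open>\<delta> * (1 - s)\<close>; atom \<open>c\<close> absorbs the rest of the mass and of the budget. Before
  merging \<open>a\<close> and \<open>b\<close> all quotients \<open>q i * U' (e i) / p i\<close> equal \<open>1 / Z\<close>. The merge leaves the
  quotient at \<open>c\<close> unchanged, so the quotient at the merged atom must also be \<open>1 / Z\<close>.
\<close>

lemma (in smooth_utility) inverse_derivative_affine:
  assumes coh: "coherent_for_pmfs TYPE('a) U" and inf: "infinite (UNIV :: 'a set)"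
    and xy: "0 < x" "0 < y" and s: "0 < s" "s < 1"
  shows "1 / U' (s * x + (1 - s) * y) = s / U' x + (1 - s) / U' y"
proof -
  obtain T :: "'a set" where "finite T" "card T = 3"
    using inf infinite_arbitrarily_large by blast
  then obtain a b c where abc: "a \<noteq> b" "a \<noteq> c" "b \<noteq> (c::'a)"
    by (auto simp: card_3_iff)
  let ?S = "{a, b, c}"
  define m where "m = s * x + (1 - s) * y"
  \<comment> \<open>Any \<open>\<delta> < 1\<close> with \<open>\<delta> * m < 1\<close> leaves a positive mass and a positive budget for the atom \<open>c\<close>.\<close>
  define \<delta> where "\<delta> = 1 / (1 + x + y)"
  have m: "0 < m" "m < 1 + x + y"
    unfolding m_def using xy s by (auto intro: add_pos_pos) (smt (verit) mult_less_cancel_right2 mult_pos_pos)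
  have \<delta>: "0 < \<delta>" "\<delta> < 1" "\<delta> * m < 1"
    using xy m by (auto simp: \<delta>_def field_simps)
  define z where "z = (1 - \<delta> * m) / (1 - \<delta>)"
  have z: "0 < z" "(1 - \<delta>) * z = 1 - \<delta> * m"
    using \<delta> by (auto simp: z_def)
  define e where "e i = (if i = a then x else if i = b then y else z)" for i
  have e_simps: "e a = x" "e b = y" "e c = z"
    using abc by (auto simp: e_def)
  have e_pos: "0 < e i" for i
    using xy z by (auto simp: e_def)
  obtain p where p: "set_pmf p = ?S" "pmf p a = \<delta> * s" "pmf p b = \<delta> * (1 - s)" "pmf p c = 1 - \<delta>"
  proof (rule finite_pmf_exists)
    show "finite ?S" by simp
    let ?w = "\<lambda>i. if i = a then \<delta> * s else if i = b then \<delta> * (1 - s) else 1 - \<delta>"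
    show "0 < ?w i" for i
      using \<delta> s by auto
    show "(\<Sum>i\<in>?S. ?w i) = 1"
      using abc by (simp add: algebra_simps)
  qed (use abc in auto)
  have mean: "(\<Sum>i\<in>?S. pmf p i * e i) = 1"
  proof -
    have "(\<Sum>i\<in>?S. pmf p i * e i) = \<delta> * s * x + \<delta> * (1 - s) * y + (1 - \<delta>) * z"
      using abc by (simp add: p e_simps)
    then show ?thesis
      unfolding z(2) by (simp add: m_def algebra_simps)
  qed
  \<comment> \<open>The weights \<open>p / U' e\<close>, normalized by \<open>Z\<close>, form the alternative against which \<open>e\<close> is optimal.\<close>
  define Z where "Z = (\<Sum>i\<in>?S. pmf p i / U' (e i))"
  have w_pos: "0 < pmf p i / U' (e i)" if "i \<in> ?S" for i
    using that U'_pos[OF e_pos] p(1) by (intro divide_pos_pos pmf_positive) auto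
  have Z: "0 < Z"
    unfolding Z_def using w_pos by (intro sum_pos) auto
  obtain q where q: "set_pmf q = ?S" "\<And>i. i \<in> ?S \<Longrightarrow> pmf q i = pmf p i / U' (e i) / Z"
  proof (rule finite_pmf_exists)
    show "(\<Sum>i\<in>?S. pmf p i / U' (e i) / Z) = 1"
      using Z unfolding sum_divide_distrib[symmetric] Z_def[symmetric] by simp
    show "0 < pmf p i / U' (e i) / Z" if "i \<in> ?S" for i
      using w_pos[OF that] Z by (rule divide_pos_pos)
  qed auto
  let ?\<epsilon> = "\<lambda>i. ennreal (e i)"
  have opt: "U_optimal U (measure_pmf p) (measure_pmf q) ?\<epsilon>"
  proof (rule U_optimal_pmfI[where e = e and K = "1 / Z"])
    show "pmf q i * U' (e i) = 1 / Z * pmf p i" if "i \<in> set_pmf p" for i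
      using q(2)[of i] U'_pos[OF e_pos[of i]] that p(1) by (simp add: field_simps)
  qed (use p(1) q(1) e_pos mean Z in auto)
  have fin: "expected_utility (measure_pmf q) U ?\<epsilon> < \<infinity>"
    using q(1) e_pos by (subst expected_utility_pmf[of q _ e]) auto
  define f where "f = id(b := a)"
  have fib: "f -` {f a} \<inter> ?S = {a, b}" "f -` {f c} \<inter> ?S = {c}" "f a = a" "f b = a" "f c = c"
    using abc by (auto simp: f_def)
  define E where "E = nn_cond_exp (measure_pmf p) (fibre_algebra f) ?\<epsilon>"
  have E_meas: "E \<in> borel_measurable (fibre_algebra f)"
    unfolding E_def by (rule borel_measurable_nn_cond_exp)
  have "E i = E (f i)" for i
    by (rule measurable_fibre_algebra_const[OF E_meas]) (auto simp: f_def)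
  then have E_f: "E = (\<lambda>i. E (f i))"
    by (rule ext)
  have map_opt: "U_optimal U (measure_pmf (map_pmf f p)) (measure_pmf (map_pmf f q)) E"
  proof (rule U_optimal_fibre_algebraD, subst E_f[symmetric])
    show "U_optimal U (restr_to_subalg (measure_pmf p) (fibre_algebra f))
      (restr_to_subalg (measure_pmf q) (fibre_algebra f)) E"
      using coh opt fin p(1) q(1) unfolding coherent_for_pmfs_def E_def by blast
  qed
  have fibre_measure: "measure (measure_pmf r) (f -` {f i}) = sum (pmf r) (f -` {f i} \<inter> ?S)"
    if "set_pmf r = ?S" for r i
    using that measure_Int_set_pmf[of r "f -` {f i}"] by (simp add: measure_measure_pmf_finite)
  have E_fibre: "E i * ennreal (sum (pmf p) (f -` {f i} \<inter> ?S)) =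
      ennreal (\<Sum>j\<in>f -` {f i} \<inter> ?S. pmf p j * e j)" for i
  proof -
    have "E i * ennreal (sum (pmf p) (f -` {f i} \<inter> ?S)) =
        (\<integral>\<^sup>+j. indicator (f -` {f i}) j * ?\<epsilon> j \<partial>measure_pmf p)"
      using nn_cond_exp_fibre[of p f ?\<epsilon> i]
      by (simp add: E_def fibre_measure[OF p(1)] measure_pmf.emeasure_eq_measure)
    also have "\<dots> = (\<Sum>j\<in>f -` {f i} \<inter> ?S. indicator (f -` {f i}) j * ?\<epsilon> j * pmf p j)"
      by (rule nn_integral_measure_pmf_support) (auto simp: p(1))
    also have "\<dots> = (\<Sum>j\<in>f -` {f i} \<inter> ?S. ennreal (pmf p j * e j))"
      by (intro sum.cong) (simp_all add: ennreal_mult'' mult.commute)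
    also have "\<dots> = ennreal (\<Sum>j\<in>f -` {f i} \<inter> ?S. pmf p j * e j)"
      using e_pos by (intro sum_ennreal) (simp add: less_imp_le)
    finally show ?thesis .
  qed
  have cancel: "v = ennreal r" if "v * ennreal k = ennreal (k * r)" "0 < k" "0 \<le> r" for v k r
    using that by (cases v) (auto simp: ennreal_mult[symmetric] mult.commute ennreal_top_mult)
  have "E a * ennreal \<delta> = ennreal (\<delta> * m)"
  proof -
    have "sum (pmf p) {a, b} = \<delta>" "(\<Sum>j\<in>{a, b}. pmf p j * e j) = \<delta> * m"
      using abc by (simp_all add: p e_simps m_def algebra_simps)
    then show ?thesis
      using E_fibre[of a] unfolding fib(1) by simp
  qed
  then have E_a: "E a = ennreal m"
    by (rule cancel) (use \<delta> m in auto)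
  have "E c * ennreal (1 - \<delta>) = ennreal ((1 - \<delta>) * z)"
    using E_fibre[of c] abc unfolding fib(2) by (simp add: p e_simps)
  then have E_c: "E c = ennreal z"
    by (rule cancel) (use \<delta> z in auto)
  have pmf_map_f: "pmf (map_pmf f r) (f i) = sum (pmf r) (f -` {f i} \<inter> ?S)" if "set_pmf r = ?S" for r i
    by (simp add: pmf_map fibre_measure[OF that])
  have "pmf (map_pmf f q) a * U' m / pmf (map_pmf f p) a = pmf (map_pmf f q) c * U' z / pmf (map_pmf f p) c"
  proof -
    have "pmf (map_pmf f q) a * U' (if a = a then m else z) / pmf (map_pmf f p) a =
        pmf (map_pmf f q) c * U' (if c = a then m else z) / pmf (map_pmf f p) c"
      by (rule U_optimal_pmfD[OF _ _ _ map_opt, of "\<lambda>i. if i = a then m else z"])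
        (use abc m(1) z(1) E_a E_c in \<open>auto simp: p(1) q(1) fib(3-5)\<close>)
    then show ?thesis
      using abc by simp
  qed
  moreover have "pmf (map_pmf f p) a = \<delta>" "pmf (map_pmf f p) c = 1 - \<delta>"
    using pmf_map_f[OF p(1), of a] pmf_map_f[OF p(1), of c] abc
    unfolding fib(1,2) unfolding fib(3-5) by (simp_all add: p algebra_simps)
  moreover have "pmf (map_pmf f q) a = \<delta> * (s / U' x + (1 - s) / U' y) / Z"
    "pmf (map_pmf f q) c = (1 - \<delta>) / U' z / Z"
    using pmf_map_f[OF q(1), of a] pmf_map_f[OF q(1), of c] abc
    unfolding fib(1,2) unfolding fib(3-5) by (simp_all add: p q(2) e_simps add_divide_distrib distrib_left)
  moreover have "\<delta> * B / Z * U' m / \<delta> = B * U' m / Z" for B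
    using \<delta> by simp
  moreover have "(1 - \<delta>) / U' z / Z * U' z / (1 - \<delta>) = 1 / Z"
    using \<delta> U'_pos[OF z(1)] by simp
  ultimately have "(s / U' x + (1 - s) / U' y) * U' m / Z = 1 / Z"
    by simp
  then have "(s / U' x + (1 - s) / U' y) * U' m = 1"
    using Z by simp
  then show ?thesis
    using U'_pos[OF m(1)] by (simp add: m_def field_simps)
qed

text \<open>
  Letting \<open>y\<close> tend to \<open>0\<close> in the functional equation removes the second summand, since \<open>1 / U'\<close>
  vanishes at \<open>0\<close>. What remains is homogeneity: \<open>1 / U' (s * x) = s / U' x\<close> for \<open>0 < s < 1\<close>.
\<close>

lemma (in smooth_utility) derivative_reciprocal:
  assumes coh: "coherent_for_pmfs TYPE('a) U" and inf: "infinite (UNIV :: 'a set)"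
    and continuous: "continuous_on {0<..} U'"
    and limit_zero: "filterlim U' at_top (at_right 0)"
    and x: "0 < x"
  shows "U' x = U' 1 / x"
proof -
  have scale: "1 / U' (s * x) = s / U' x" if x: "0 < x" and s: "0 < s" "s < 1" for s x
  proof -
    have "((\<lambda>y. inverse (U' y)) \<longlongrightarrow> 0) (at_right 0)"
      using limit_zero by (intro tendsto_inverse_0_at_top)
    then have "((\<lambda>y. s / U' x + (1 - s) * inverse (U' y)) \<longlongrightarrow> s / U' x + (1 - s) * 0) (at_right 0)"
      by (intro tendsto_add tendsto_mult tendsto_const)
    then have right: "((\<lambda>y. s / U' x + (1 - s) / U' y) \<longlongrightarrow> s / U' x) (at_right 0)"
      by (simp add: divide_inverse)
    have "isCont U' (s * x + (1 - s) * 0)"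
      using continuous x s by (simp add: continuous_on_eq_continuous_at)
    moreover have "((\<lambda>y. s * x + (1 - s) * y) \<longlongrightarrow> s * x + (1 - s) * 0) (at_right 0)"
      by (intro tendsto_intros)
    ultimately have "((\<lambda>y. U' (s * x + (1 - s) * y)) \<longlongrightarrow> U' (s * x)) (at_right 0)"
      using isCont_tendsto_compose by fastforce
    then have left: "((\<lambda>y. 1 / U' (s * x + (1 - s) * y)) \<longlongrightarrow> 1 / U' (s * x)) (at_right 0)"
      using U'_pos[of "s * x"] x s by (intro tendsto_divide tendsto_const) auto
    have "\<forall>\<^sub>F y in at_right 0. 1 / U' (s * x + (1 - s) * y) = s / U' x + (1 - s) / U' y"
      using eventually_at_right_less[of "0::real"]
      by eventually_elim (rule inverse_derivative_affine[OF coh inf x _ s])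
    from tendsto_cong[OF this] left
    have "((\<lambda>y. s / U' x + (1 - s) / U' y) \<longlongrightarrow> 1 / U' (s * x)) (at_right 0)"
      by blast
    then show ?thesis
      using right by (rule tendsto_unique[OF trivial_limit_at_right_real])
  qed
  consider "x < 1" | "x = 1" | "1 < x" by linarith
  then show ?thesis
  proof cases
    case 1
    then show ?thesis
      using scale[of 1 x] x U'_pos[of x] U'_pos[of 1] by (simp add: field_simps)
  next
    case 3
    then show ?thesis
      using scale[of x "1 / x"] x U'_pos[of x] U'_pos[of 1] by (simp add: field_simps)
  qed simp
qed

theorem proposition6:
  fixes U :: "ennreal \<Rightarrow> ereal" and U' :: "real \<Rightarrow> real"
  assumes real_valued: "\<And>x. 0 < x \<Longrightarrow> x < \<infinity> \<Longrightarrow> \<bar>U x\<bar> \<noteq> \<infinity>"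
    and concave: "concave_utility U"
    and increasing: "strict_mono U"
    and derivative: "\<And>x::real. 0 < x \<Longrightarrow>
      ((\<lambda>y. real_of_ereal (U (ennreal y))) has_real_derivative U' x) (at x)"
    and continuous: "continuous_on {0<..} U'"
    and decreasing: "strict_antimono_on {0<..} U'"
    and limit_zero: "filterlim U' at_top (at_right 0)"
    and limit_infinity: "(U' \<longlongrightarrow> 0) at_top"
    and infinite_universe: "infinite (UNIV :: 'a set)"
    and coherent: "\<And>(P :: 'a measure) (Q :: 'a measure) (F :: 'a measure) (\<epsilon> :: 'a \<Rightarrow> ennreal).
      prob_space P \<Longrightarrow> prob_space Q \<Longrightarrow> sets Q = sets P \<Longrightarrow> absolutely_continuous P Q \<Longrightarrow>
      subalgebra P F \<Longrightarrow>
      U_optimal U P Q \<epsilon> \<Longrightarrow> expected_utility Q U \<epsilon> < \<infinity> \<Longrightarrow>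
      U_optimal U (restr_to_subalg P F) (restr_to_subalg Q F) (nn_cond_exp P F \<epsilon>)"
  shows "\<exists>c d :: real. c > 0 \<and> (\<forall>x::real. x > 0 \<longrightarrow> U (ennreal x) = ereal (c * ln x + d))"
proof -
  interpret smooth_utility U U'
    using real_valued increasing derivative decreasing limit_infinity by (rule smooth_utility.intro)
  have coh: "coherent_for_pmfs TYPE('a) U"
    unfolding coherent_for_pmfs_def
  proof (intro allI impI)
    fix p q :: "'a pmf" and f :: "'a \<Rightarrow> 'a" and \<epsilon> :: "'a \<Rightarrow> ennreal"
    assume supp: "set_pmf q = set_pmf p"
      and opt: "U_optimal U (measure_pmf p) (measure_pmf q) \<epsilon>"
        "expected_utility (measure_pmf q) U \<epsilon> < \<infinity>"
    have "absolutely_continuous (measure_pmf p) (measure_pmf q)"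
      using supp by (intro absolutely_continuous_pmf) simp
    from coherent[OF prob_space_measure_pmf prob_space_measure_pmf _ this subalgebra_fibre_algebra opt]
    show "U_optimal U (restr_to_subalg (measure_pmf p) (fibre_algebra f))
        (restr_to_subalg (measure_pmf q) (fibre_algebra f))
        (nn_cond_exp (measure_pmf p) (fibre_algebra f) \<epsilon>)"
      by simp
  qed
  note deriv_eq = derivative_reciprocal[OF coh infinite_universe continuous limit_zero]
  have "((\<lambda>x. u x - U' 1 * ln x) has_field_derivative 0) (at x within {0<..})" if "x \<in> {0<..}" for x
  proof (rule has_field_derivative_at_within)
    have "((\<lambda>x. u x - U' 1 * ln x) has_field_derivative U' x - U' 1 * inverse x) (at x)"
      using u_deriv[of x] that by (intro DERIV_diff DERIV_cmult DERIV_ln) auto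
    then show "((\<lambda>x. u x - U' 1 * ln x) has_field_derivative 0) (at x)"
      using deriv_eq[of x] that by (simp add: divide_inverse)
  qed
  then have "\<exists>d. \<forall>x\<in>{0<..}. u x - U' 1 * ln x = d"
    by (intro has_field_derivative_zero_constant) auto
  then obtain d where "\<And>x. x \<in> {0<..} \<Longrightarrow> u x - U' 1 * ln x = d"
    by blast
  then have "\<forall>x::real. x > 0 \<longrightarrow> U (ennreal x) = ereal (U' 1 * ln x + d)"
    by (metis U_eq_u add.commute diff_add_cancel greaterThan_iff)
  then show ?thesis
    using U'_pos[of 1] by auto
qed

end
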